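(* Consider the constrained single-input flat system $\dot{x}=f(x)+g(x)u$, $|u|\le\bar u$, its linearizing maps $x=\phi_x(z)$, $u=\phi_u(z,v)$, its linear form $\dot z=Az+Bv$, and the inner constraint set $\tilde{\mathcal V}$ obtained from a ReLU-network approximation of $\phi_u$ (all as in the context). Let $K\in\mathbb{R}^{1\times n}$, let $P\in\mathbb{R}^{n\times n}$ be symmetric positive definite, let $V_z(z)=z^\top P z$, and suppose that for some scalar $\kappa>0$ $$\nabla V_z(z)^\top (A+BK)z\le -\kappa V_z(z)\qquad\text{for all } z\in\mathbb{R}^n .$$ Let $\varepsilon>0$ be such that $$\mathcal{E}(P,\varepsilon):=\{z\in\mathbb{R}^n: z^\top P z\le\varepsilon\}\ \subseteq\ \mathcal{Z}_K:=\{z\in\mathbb{R}^n:(z,Kz)\in\tilde{\mathcal V}\}.$$ Then: (i) $\mathcal{E}(P,\varepsilon)$ is positively invariant for $\dot z=Az+Bv$ under the feedback $v=Kz$, and this feedback respects the constraint there: $|\phi_u(z,Kz)|\le\bar u$ for all $z\in\mathcal{E}(P,\varepsilon)$. (ii) Define $V_x(x)=\phi_x^{-1}(x)^\top P\,\phi_x^{-1}(x)$ for $x\in D_x$. The set $\mathcal{X}_K=\{x\in D_x: V_x(x)\le\varepsilon\}$ is positively invariant for $\dot x=f(x)+g(x)u$ under the feedback $$u=\mu_K(x):=\phi_u\big(\phi_x^{-1}(x),K\phi_x^{-1}(x)\big),$$ which satisfies $|\mu_K(x)|\le\bar u$ for all $x\in\mathcal{X}_K$, and $V_x$ is an associated control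 Lyapunov function: it is positive definite and decreases along closed-loop trajectories starting in $\mathcal{X}_K$ (strictly, as long as the state is not the equilibrium $x=0$).
   Context: System and flatness. The system is $\dot x=f(x)+g(x)u$ with state $x\in\mathbb{R}^n$, input $u\in\mathbb{R}$ and constraint $|u|\le\bar u$, $\bar u>0$. It is differentially flat, hence linearizable by static feedback: there are open sets $D_z,D_x\subseteq\mathbb{R}^n$ containing the origin, a diffeomorphism $\phi_x:D_z\to D_x$ and a continuous map $\phi_u:D_z\times\mathbb{R}\to\mathbb{R}$ such that under $x=\phi_x(z)$, $u=\phi_u(z,v)$ the dynamics become $\dot z=Az+Bv$, i.e. for all $(z,v)\in D_z\times\mathbb{R}$, $$D\phi_x(z)\,(Az+Bv)=f(\phi_x(z))+g(\phi_x(z))\,\phi_u(z,v),$$ where $D\phi_x$ is the Jacobian and $(A,B)$ is the state-space form of the chain of integrators $y^{(n)}=v$ with $z=(y,\dot y,\dots,y^{(n-1)})^\top$ (so $\dot z_i=z_{i+1}$ for $i<n$ and $\dot z_n=v$). The equilibrium $z=0,v=0$ corresponds to $x=0,u=0$: $\phi_x(0)=0$, $\phi_u(0,0)=0$. ReLU approximation and inner constraint set. Let $\tilde\phi_u$ be a single-hidden-layer ReLU network, $\tilde\phi_u(z,v)=W^{[2]}\sigma\big(W^{[1]}\zeta+b^{[1]}\big)+b^{[2]}$ with $\zeta=(z^\top,v)^\top$ and $\sigma(s)=\max(s,0)$ componentwise. Let $\mathcal{Z}_w\subset D_z\times\mathbb{R}$ be a compact workspace on which $$\sup_{(z,v)\in\mathcal{Z}_w}|\phi_u(z,v)-\tilde\phi_u(z,v)|\le\epsilon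 .$$ Set $\tilde{\mathcal V}=\{(z,v)\in\mathcal{Z}_w:|\tilde\phi_u(z,v)|\le\bar u-\epsilon\}$. Positive invariance. Given a feedback $u=\mu(x)$, a set $\mathcal S$ is positively invariant for the closed loop if every solution with $x(0)\in\mathcal S$ satisfies $x(t)\in\mathcal S$ for all $t>0$. *)

theory Defs
  imports "HOL-Analysis.Analysis"
begin

text \<open>
  The index type \<open>'n\<close> of the state space carries a linear order, so that its elements
  \<open>i\<^sub>1 < \<dots> < i\<^sub>n\<close> enumerate the derivatives
  \<open>z = (y, y', \<dots>, y\<^bsup>(n-1)\<^esup>)\<close> of the flat output.  An input
  matrix is an \<open>n \<times> 1\<close> matrix, a feedback gain is a \<open>1 \<times> n\<close> matrix, and
  \<open>vec v\<close> is the scalar \<open>v\<close> read as a vector of length 1.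
\<close>

type_synonym 'n rvec = "real^'n"

definition chain_A :: "(real^('n::{finite,linorder}), 'n) vec" where
  "chain_A = (\<chi> i j. if i < j \<and> (\<nexists>k. i < k \<and> k < j) then 1 else 0)"

definition chain_B :: "real^1^('n::{finite,linorder})" where
  "chain_B = (\<chi> i j. if \<forall>k. k \<le> i then 1 else 0)"

definition linear_dynamics :: "'n rvec \<Rightarrow> real \<Rightarrow> ('n::{finite,linorder}) rvec" where
  "linear_dynamics z v = chain_A *v z + chain_B *v vec v"

definition affine_dynamics ::
    "('s \<Rightarrow> 's) \<Rightarrow> ('s \<Rightarrow> 's) \<Rightarrow> 's \<Rightarrow> real \<Rightarrow> ('s::real_vector)" where
  "affine_dynamics f g x u = f x + u *\<^sub>R g x"

definition linear_feedback :: "real^'n^1 \<Rightarrow> real^'n \<Rightarrow> real" where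
  "linear_feedback K z = (K *v z) $ 1"

definition closed_loop :: "('s \<Rightarrow> real \<Rightarrow> 's) \<Rightarrow> ('s \<Rightarrow> real) \<Rightarrow> 's \<Rightarrow> 's" where
  "closed_loop F \<mu> x = F x (\<mu> x)"

text \<open>Only used for open sets \<open>S\<close>, where \<open>at x within S\<close> is \<open>at x\<close>.\<close>

definition C1_on :: "(real^'n) set \<Rightarrow> (real^'n \<Rightarrow> real^'n) \<Rightarrow> bool" where
  "C1_on S h \<longleftrightarrow> h differentiable_on S \<and> continuous_on S (\<lambda>x. jacobian h (at x))"

definition diffeomorphism :: "(real^'n) set \<Rightarrow> (real^'n) set \<Rightarrow> (real^'n \<Rightarrow> real^'n) \<Rightarrow> bool" where
  "diffeomorphism S T h \<longleftrightarrow> open S \<and> open T \<and> bij_betw h S T \<and>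
     C1_on S h \<and> C1_on T (the_inv_into S h)"

definition linearizing_maps ::
    "('n rvec \<Rightarrow> 'n rvec) \<Rightarrow> ('n rvec \<Rightarrow> 'n rvec) \<Rightarrow>
     'n rvec set \<Rightarrow> 'n rvec set \<Rightarrow> ('n rvec \<Rightarrow> 'n rvec) \<Rightarrow>
     (('n::{finite,linorder}) rvec \<Rightarrow> real \<Rightarrow> real) \<Rightarrow> bool" where
  "linearizing_maps f g Dz Dx \<phi>x \<phi>u \<longleftrightarrow>
     0 \<in> Dz \<and> 0 \<in> Dx \<and> diffeomorphism Dz Dx \<phi>x \<and>
     continuous_on (Dz \<times> UNIV) (\<lambda>(z, v). \<phi>u z v) \<and>
     (\<forall>z\<in>Dz. \<forall>v. jacobian \<phi>x (at z) *v linear_dynamics z v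
                  = affine_dynamics f g (\<phi>x z) (\<phi>u z v)) \<and>
     \<phi>x 0 = 0 \<and> \<phi>u 0 0 = 0"

definition relu :: "real^'h \<Rightarrow> real^'h" where
  "relu s = (\<chi> i. max (s $ i) 0)"

definition stack :: "real^'n \<Rightarrow> real \<Rightarrow> real^('n + 1)" where
  "stack z v = (\<chi> i. case i of Inl j \<Rightarrow> z $ j | Inr _ \<Rightarrow> v)"

definition relu_network ::
    "real^('n + 1)^'h \<Rightarrow> real^'h \<Rightarrow> real^'h^1 \<Rightarrow> real^1 \<Rightarrow> real^'n \<Rightarrow> real \<Rightarrow> real" where
  "relu_network W1 b1 W2 b2 z v = (W2 *v relu (W1 *v stack z v + b1) + b2) $ 1"

definition inner_constraint_set ::
    "('s \<times> real) set \<Rightarrow> ('s \<Rightarrow> real \<Rightarrow> real) \<Rightarrow> real \<Rightarrow> real \<Rightarrow> ('s \<times> real) set" where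
  "inner_constraint_set Zw \<psi> ubar err = {(z, v) \<in> Zw. \<bar>\<psi> z v\<bar> \<le> ubar - err}"

text \<open>The vector \<open>D\<close> is unique wherever \<open>h\<close> is differentiable.\<close>

definition gradient :: "('s::real_inner \<Rightarrow> real) \<Rightarrow> 's \<Rightarrow> 's" where
  "gradient h x = (THE D. GDERIV h x :> D)"

definition quad :: "real^'n^'n \<Rightarrow> real^'n \<Rightarrow> real" where
  "quad P z = z \<bullet> (P *v z)"

definition pos_def_matrix :: "real^'n^'n \<Rightarrow> bool" where
  "pos_def_matrix P \<longleftrightarrow> transpose P = P \<and> (\<forall>z. z \<noteq> 0 \<longrightarrow> quad P z > 0)"

definition ellipsoid :: "real^'n^'n \<Rightarrow> real \<Rightarrow> (real^'n) set" where
  "ellipsoid P \<epsilon> = {z. quad P z \<le> \<epsilon>}"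

definition lyapunov_x ::
    "(real^'n) set \<Rightarrow> (real^'n \<Rightarrow> real^'n) \<Rightarrow> real^'n^'n \<Rightarrow> real^'n \<Rightarrow> real" where
  "lyapunov_x Dz \<phi>x P x = quad P (the_inv_into Dz \<phi>x x)"

definition feedback_x ::
    "(real^'n) set \<Rightarrow> (real^'n \<Rightarrow> real^'n) \<Rightarrow> (real^'n \<Rightarrow> real \<Rightarrow> real) \<Rightarrow>
     real^'n^1 \<Rightarrow> real^'n \<Rightarrow> real" where
  "feedback_x Dz \<phi>x \<phi>u K x =
     \<phi>u (the_inv_into Dz \<phi>x x) (linear_feedback K (the_inv_into Dz \<phi>x x))"

text \<open>
  Solutions of \<open>x' = F x\<close> for a vector field \<open>F\<close> that is meaningful on \<open>D\<close> only,
  on an arbitrary time interval \<open>J \<subseteq> [0, \<infinity>)\<close> that starts at 0.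
\<close>

definition solution ::
    "('s::real_normed_vector \<Rightarrow> 's) \<Rightarrow> 's set \<Rightarrow> real set \<Rightarrow> (real \<Rightarrow> 's) \<Rightarrow> bool" where
  "solution F D J x \<longleftrightarrow> is_interval J \<and> 0 \<in> J \<and> J \<subseteq> {0..} \<and>
     (\<forall>t\<in>J. x t \<in> D \<and> (x has_vector_derivative F (x t)) (at t within J))"

text \<open>
  A solution given on a bounded interval has to be continuable to all of \<open>[0, \<infinity>)\<close>
  inside \<open>S\<close>, so invariance excludes finite escape times.  The interval \<open>J = {0}\<close>
  imposes no differential equation; this instance says that a global solution starts
  at every point of \<open>S\<close>.
\<close>

definition positively_invariant ::
    "('s::real_normed_vector \<Rightarrow> 's) \<Rightarrow> 's set \<Rightarrow> 's set \<Rightarrow> bool" where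
  "positively_invariant F D S \<longleftrightarrow> S \<subseteq> D \<and>
     (\<forall>J x. solution F D J x \<and> x 0 \<in> S \<longrightarrow>
        (\<exists>y. solution F D {0..} y \<and> (\<forall>t\<in>J. y t = x t) \<and> (\<forall>t>0. y t \<in> S)))"

text \<open>
  Here \<open>F\<close> is the closed loop under the feedback associated with \<open>V\<close>.
  The decrease is that of the values of \<open>V\<close> along each solution starting in
  \<open>S\<close>, strict from every time at which the state is not the equilibrium.
\<close>

definition control_lyapunov_function ::
    "('s::real_normed_vector \<Rightarrow> 's) \<Rightarrow> 's set \<Rightarrow> 's set \<Rightarrow> ('s \<Rightarrow> real) \<Rightarrow> bool" where
  "control_lyapunov_function F D S V \<longleftrightarrow>
     V 0 = 0 \<and> (\<forall>x\<in>D. x \<noteq> 0 \<longrightarrow> V x > 0) \<and>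
     (\<forall>J x. solution F D J x \<and> x 0 \<in> S \<longrightarrow>
        (\<forall>s\<in>J. \<forall>t\<in>J. s < t \<longrightarrow>
           V (x t) \<le> V (x s) \<and> (x s \<noteq> 0 \<longrightarrow> V (x t) < V (x s))))"

end

theory Submission
  imports Defs
begin

text \<open>
  Along \<open>z' = M z\<close> the function \<open>exp (\<kappa> t) * quad P (z t)\<close> is nonincreasing.  This
  yields the invariance of the ellipsoid, the strict decrease away from the equilibrium and,
  applied to the difference of two solutions, uniqueness.  The closed loop in \<open>x\<close> is conjugate to
  \<open>z' = M z\<close> under the diffeomorphism \<open>\<phi>x\<close>, so its solutions are exactly the images of
  those solutions that stay in \<open>Dz\<close>, and its sublevel set is the image of the ellipsoid.
\<close>

section \<open>Linear systems: decay of the quadratic form, existence, uniqueness,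
  invariance\<close>

lemma has_derivative_quad:
  "(quad P has_derivative (\<lambda>h. h \<bullet> (P *v z) + z \<bullet> (P *v h))) (at z)"
proof -
  have "((*v) P has_derivative (*v) P) (at z)"
    by (simp add: bounded_linear_imp_has_derivative)
  from has_derivative_inner[OF has_derivative_ident this] show ?thesis
    by (simp add: quad_def[abs_def] add.commute)
qed

text \<open>\<open>gradient\<close> is a definite description, so it has to be shown that exactly
  one vector qualifies. Symmetry of \<open>P\<close> merges the two terms of the product rule into
  the inner product with \<open>2 *\<^sub>R (P *v z)\<close>, and uniqueness of derivatives excludes
  any other vector.\<close>

lemma GDERIV_quad:
  assumes "transpose P = P"
  shows "GDERIV (quad P) z :> gradient (quad P) z"
proof -
  have "z \<bullet> (P *v h) = h \<bullet> (P *v z)" for h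
    by (metis assms dot_lmul_matrix inner_commute transpose_matrix_vector)
  with has_derivative_quad[of P z] have G: "GDERIV (quad P) z :> 2 *\<^sub>R (P *v z)"
    by (simp add: gderiv_def)
  moreover have "D = 2 *\<^sub>R (P *v z)" if "GDERIV (quad P) z :> D" for D
  proof -
    have "(\<lambda>h. h \<bullet> D) = (\<lambda>h. h \<bullet> (2 *\<^sub>R (P *v z)))"
      using that G has_derivative_unique unfolding gderiv_def by blast
    then show ?thesis
      by (metis vector_eq_rdot inner_commute)
  qed
  ultimately show ?thesis
    unfolding gradient_def by (metis theI)
qed

text \<open>Gronwall's argument: the decay hypothesis makes the derivative of
  \<open>exp (\<kappa> * r) * quad P (z r)\<close> nonpositive. Two arbitrary times of
  \<open>J\<close> are compared, because strict decrease is later claimed from every time, while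
  invariance and uniqueness take \<open>s = 0\<close>.\<close>

lemma quad_decay:
  assumes P: "transpose P = P"
    and V: "\<And>z. gradient (quad P) z \<bullet> (M *v z) \<le> - \<kappa> * quad P z"
    and z: "solution ((*v) M) UNIV J z" and st: "s \<in> J" "t \<in> J" "s \<le> t"
  shows "quad P (z t) \<le> exp (- \<kappa> * (t - s)) * quad P (z s)"
proof -
  have J: "{s..t} \<subseteq> J"
    using z st unfolding solution_def by (meson atLeastAtMost_iff is_interval_1 subsetI)
  have z': "(z has_vector_derivative M *v z r) (at r within {s..t})" if "r \<in> {s..t}" for r
    using z J that unfolding solution_def by (meson has_vector_derivative_within_subset subsetD)
  let ?W = "\<lambda>r. exp (\<kappa> * r) * quad P (z r)"
  have "?W t \<le> ?W s"
  \<comment> \<open>At an end point of \<open>J\<close> only a one-sided derivative is known. This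
    rule asks for two-sided derivatives in the interior and mere continuity on the closed
    interval.\<close>
  proof (rule DERIV_nonpos_imp_decreasing_open[OF st(3)])
    fix r assume r: "s < r" "r < t"
    then have zr: "(z has_vector_derivative M *v z r) (at r)"
      using z'[of r] by (simp add: at_within_Icc_at)
    have "((\<lambda>r. quad P (z r)) has_real_derivative (gradient (quad P) (z r) \<bullet> (M *v z r))) (at r)"
      using vector_derivative_diff_chain_within[OF zr
          has_derivative_at_withinI[OF GDERIV_quad[OF P, unfolded gderiv_def]]]
      by (simp add: o_def has_real_derivative_iff_has_vector_derivative inner_commute)
    then have "(?W has_real_derivative
        exp (\<kappa> * r) * (\<kappa> * quad P (z r) + gradient (quad P) (z r) \<bullet> (M *v z r))) (at r)"
      by (auto intro!: derivative_eq_intros simp: algebra_simps)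
    moreover have "exp (\<kappa> * r) * (\<kappa> * quad P (z r) + gradient (quad P) (z r) \<bullet> (M *v z r)) \<le> 0"
      using V[of "z r"] by (simp add: mult_le_0_iff)
    ultimately show "\<exists>y. (?W has_real_derivative y) (at r) \<and> y \<le> 0"
      by blast
  next
    have "continuous_on {s..t} z"
      using z' continuous_on_eq_continuous_within has_vector_derivative_continuous by blast
    then show "continuous_on {s..t} ?W"
      unfolding quad_def by (intro continuous_intros continuous_on_compose2[OF
          matrix_vector_mult_linear_continuous_on[of UNIV P]]) auto
  qed
  then have "exp (- \<kappa> * t) * ?W t \<le> exp (- \<kappa> * t) * ?W s"
    by simp
  moreover have "exp (- \<kappa> * t) * ?W t = quad P (z t)"
    by (simp add: exp_minus_inverse exp_minus)
  moreover have "exp (- \<kappa> * t) * ?W s = exp (- \<kappa> * (t - s)) * quad P (z s)"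
    by (simp add: right_diff_distrib exp_diff exp_minus field_simps)
  ultimately show ?thesis
    by (simp only:)
qed

text \<open>The coordinates of the matrix exponential applied to \<open>z\<^sub>0\<close> are power series.\<close>

lemma linear_ode_global_solution:
  fixes M :: "real^'n^'n"
  obtains z where "z 0 = z\<^sub>0" "solution ((*v) M) UNIV {0..} z"
proof -
  define a where "a n = (((*v) M) ^^ n) z\<^sub>0" for n
  define c where "c i n = a n $ i / fact n" for i n
  define z where "z t = (\<chi> i. \<Sum>n. c i n * t ^ n)" for t
  have a_Suc: "a (Suc n) = M *v a n" for n
    by (simp add: a_def)
  have a_bound: "norm (a n) \<le> onorm ((*v) M) ^ n * norm z\<^sub>0" for n
  proof (induction n)
    case (Suc n)
    have "norm (a (Suc n)) \<le> onorm ((*v) M) * norm (a n)"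
      by (simp add: a_Suc onorm)
    also have "\<dots> \<le> onorm ((*v) M) * (onorm ((*v) M) ^ n * norm z\<^sub>0)"
      by (intro mult_left_mono Suc onorm_pos_le) simp
    finally show ?case by simp
  qed (simp add: a_def)
  have summable: "summable (\<lambda>n. c i n * t ^ n)" for i t
  proof (rule summable_comparison_test')
    show "summable (\<lambda>n. norm z\<^sub>0 * (inverse (fact n) * (onorm ((*v) M) * \<bar>t\<bar>) ^ n))"
      by (intro summable_mult summable_exp)
    fix n
    have "\<bar>a n $ i\<bar> \<le> onorm ((*v) M) ^ n * norm z\<^sub>0"
      using a_bound component_le_norm_cart order_trans by blast
    from mult_right_mono[OF this, of "\<bar>t\<bar> ^ n / fact n"]
    show "norm (c i n * t ^ n) \<le> norm z\<^sub>0 * (inverse (fact n) * (onorm ((*v) M) * \<bar>t\<bar>) ^ n)"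
      by (simp add: c_def abs_mult power_abs field_simps)
  qed
  \<comment> \<open>The factor \<open>Suc n\<close> from termwise differentiation cancels against
    \<open>fact (Suc n)\<close>, so shifting the coefficients amounts to applying
    \<open>M\<close>.\<close>
  have diffs: "diffs (c i) n = (\<Sum>j\<in>UNIV. M $ i $ j * c j n)" for i n
  proof -
    have "diffs (c i) n = a (Suc n) $ i / fact n"
      by (simp add: diffs_def c_def del: of_nat_Suc)
    then show ?thesis
      by (simp add: c_def a_Suc matrix_vector_mult_def sum_divide_distrib)
  qed
  have comp: "((\<lambda>t. z t $ i) has_real_derivative (M *v z t) $ i) (at t)" for i t
  proof -
    have "(\<Sum>n. diffs (c i) n * t ^ n) = (\<Sum>n. \<Sum>j\<in>UNIV. M $ i $ j * (c j n * t ^ n))"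
      by (simp add: diffs sum_distrib_right mult.assoc)
    also have "\<dots> = (\<Sum>j\<in>UNIV. M $ i $ j * (\<Sum>n. c j n * t ^ n))"
      by (subst suminf_sum) (auto intro!: summable_mult summable sum.cong suminf_mult)
    also have "\<dots> = (M *v z t) $ i"
      by (simp add: z_def matrix_vector_mult_def)
    finally show ?thesis
      using termdiffs_strong_converges_everywhere[OF summable, of i t] by (simp add: z_def)
  qed
  \<comment> \<open>The basis vectors are \<open>axis i 1\<close>, so the coordinate derivatives
    suffice; they hold on the whole real line and are restricted to nonnegative times.\<close>
  have "(z has_vector_derivative M *v z t) (at t within {0..})" for t
    unfolding has_vector_derivative_def
  proof (rule iffD2[OF has_derivative_componentwise_within], rule ballI)
    fix b :: "real^'n" assume "b \<in> Basis"
    then have "\<exists>i. b = axis i 1"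
      by (simp add: Basis_vec_def)
    then obtain i where b: "b = axis i 1" ..
    have "((\<lambda>t. z t $ i) has_derivative (\<lambda>h. h * (M *v z t) $ i)) (at t within {0..})"
      by (rule has_derivative_at_withinI, subst mult_commute_abs)
        (rule comp[unfolded has_field_derivative_def])
    then show "((\<lambda>t. z t \<bullet> b) has_derivative (\<lambda>h. (h *\<^sub>R (M *v z t)) \<bullet> b))
        (at t within {0..})"
      by (simp add: b inner_axis)
  qed
  moreover have "z 0 = z\<^sub>0"
    by (simp add: vec_eq_iff z_def) (simp add: c_def a_def)
  ultimately show thesis
    using that by (auto simp: solution_def is_interval_ci)
qed

lemma solution_subset:
  assumes "solution F D J z" "D \<subseteq> D'"
  shows "solution F D' J z"
  using assms unfolding solution_def by blast

text \<open>The Lyapunov estimate takes the place of a Lipschitz argument: the difference of the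
  solutions solves the same linear equation and starts at 0, so its quadratic form is at most 0 and
  definiteness makes it vanish.\<close>

lemma linear_flow_unique:
  assumes P: "pos_def_matrix P"
    and V: "\<And>z. gradient (quad P) z \<bullet> (M *v z) \<le> - \<kappa> * quad P z"
    and x: "solution ((*v) M) UNIV J x" and y: "solution ((*v) M) UNIV J y"
    and "x 0 = y 0" "t \<in> J"
  shows "x t = y t"
proof -
  have "solution ((*v) M) UNIV J (\<lambda>t. x t - y t)"
    using x y unfolding solution_def
    by (auto simp: matrix_vector_mult_diff_distrib intro!: has_vector_derivative_diff)
  moreover have "0 \<in> J" "0 \<le> t"
    using x \<open>t \<in> J\<close> unfolding solution_def by auto
  ultimately have "quad P (x t - y t) \<le> exp (- \<kappa> * (t - 0)) * quad P (x 0 - y 0)"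
    using P V \<open>t \<in> J\<close> by (intro quad_decay) (auto simp: pos_def_matrix_def)
  then have "quad P (x t - y t) \<le> 0"
    using \<open>x 0 = y 0\<close> by (simp add: quad_def)
  then show ?thesis
    using P unfolding pos_def_matrix_def by (metis not_le right_minus_eq)
qed

lemma pos_def_nonneg: "pos_def_matrix P \<Longrightarrow> 0 \<le> quad P z"
  by (cases "z = 0") (simp add: quad_def, simp add: pos_def_matrix_def less_imp_le)

text \<open>Invariance includes continuation to all nonnegative times. The global solution with the
  same initial value serves as the continuation: it agrees with the given solution by uniqueness and
  stays in the ellipsoid by decay.\<close>

lemma ellipsoid_positively_invariant:
  assumes P: "pos_def_matrix P" and "\<kappa> > 0"
    and V: "\<And>z. gradient (quad P) z \<bullet> (M *v z) \<le> - \<kappa> * quad P z"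
  shows "positively_invariant ((*v) M) UNIV (ellipsoid P \<epsilon>)"
  unfolding positively_invariant_def
proof (intro conjI allI impI subset_UNIV)
  fix J x assume x: "solution ((*v) M) UNIV J x \<and> x 0 \<in> ellipsoid P \<epsilon>"
  obtain y where y: "y 0 = x 0" "solution ((*v) M) UNIV {0..} y"
    by (rule linear_ode_global_solution)
  have "solution ((*v) M) UNIV J y"
    using x y(2) unfolding solution_def
    by (meson has_vector_derivative_within_subset subsetD)
  then have "\<forall>t\<in>J. y t = x t"
    using linear_flow_unique[OF P V] x y(1) by blast
  moreover have "y t \<in> ellipsoid P \<epsilon>" if "t > 0" for t
  proof -
    have "quad P (y t) \<le> exp (- \<kappa> * (t - 0)) * quad P (y 0)"
      using P V that y(2) by (intro quad_decay) (auto simp: pos_def_matrix_def)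
    also have "\<dots> \<le> quad P (y 0)"
      using \<open>\<kappa> > 0\<close> that pos_def_nonneg[OF P] by (simp add: mult_left_le_one_le)
    finally show ?thesis
      using x y(1) by (simp add: ellipsoid_def)
  qed
  ultimately show "\<exists>y. solution ((*v) M) UNIV {0..} y \<and> (\<forall>t\<in>J. y t = x t) \<and>
      (\<forall>t>0. y t \<in> ellipsoid P \<epsilon>)"
    using y(2) by blast
qed

lemma closed_loop_linear:
  fixes K :: "real^('n::{finite,linorder})^1"
  shows "closed_loop linear_dynamics (linear_feedback K) = (*v) (chain_A + chain_B ** K)"
proof
  fix z
  have "vec (linear_feedback K z) = K *v z"
    by (simp add: vec_eq_iff linear_feedback_def)
  then show "closed_loop linear_dynamics (linear_feedback K) z = (chain_A + chain_B ** K) *v z"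
    by (simp add: closed_loop_def linear_dynamics_def matrix_vector_mult_add_rdistrib
        matrix_vector_mul_assoc)
qed

section \<open>Transport of solutions and invariant sets by a diffeomorphism\<close>

text \<open>The chain rule along a trajectory, with the vector fields related on \<open>S\<close>
  only. It serves both directions of the conjugacy, with \<open>h\<close> the diffeomorphism or its
  inverse.\<close>

lemma solution_compose:
  assumes z: "solution G S J z"
    and h: "\<And>z. z \<in> S \<Longrightarrow> (h has_derivative h' z) (at z)"
    and F: "\<And>z. z \<in> S \<Longrightarrow> h z \<in> T \<and> h' z (G z) = F (h z)"
  shows "solution F T J (h \<circ> z)"
  unfolding solution_def
proof (intro conjI ballI)
  show "is_interval J" "0 \<in> J" "J \<subseteq> {0..}"
    using z by (simp_all add: solution_def)
  fix t assume "t \<in> J"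
  with z have zt: "z t \<in> S" "(z has_vector_derivative G (z t)) (at t within J)"
    by (auto simp: solution_def)
  show "(h \<circ> z) t \<in> T"
    using F zt(1) by simp
  show "(h \<circ> z has_vector_derivative F ((h \<circ> z) t)) (at t within J)"
    using vector_derivative_diff_chain_within[OF zt(2) has_derivative_at_withinI[OF h[OF zt(1)]]]
      F[OF zt(1)] by simp
qed

lemma C1_on_has_derivative:
  assumes "C1_on S h" "open S" "z \<in> S"
  shows "(h has_derivative (*v) (jacobian h (at z))) (at z)"
proof -
  have "h differentiable (at z)"
    using assms unfolding C1_on_def differentiable_on_def by (metis at_within_open)
  then show ?thesis
    by (simp only: jacobian_works)
qed

text \<open>Differentiate the identity \<open>?k \<circ> h = id\<close>, valid on the open set
  \<open>S\<close>, and use uniqueness of the derivative.\<close>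

lemma jacobian_the_inv_into:
  assumes h: "diffeomorphism S T h" and z: "z \<in> S"
  shows "jacobian (the_inv_into S h) (at (h z)) *v (jacobian h (at z) *v w) = w"
proof -
  let ?k = "the_inv_into S h"
  have S: "open S" "open T" "inj_on h S" "h z \<in> T" "C1_on S h" "C1_on T ?k"
    using h z by (auto simp: diffeomorphism_def bij_betw_def)
  have "(?k \<circ> h has_derivative
      (*v) (jacobian ?k (at (h z))) \<circ> (*v) (jacobian h (at z))) (at z)"
    using S z by (intro diff_chain_at C1_on_has_derivative)
  then have "(id has_derivative
      (*v) (jacobian ?k (at (h z))) \<circ> (*v) (jacobian h (at z))) (at z)"
    by (rule has_derivative_transform_within_open[OF _ \<open>open S\<close> z])
      (simp add: the_inv_into_f_f[OF \<open>inj_on h S\<close>])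
  then have "(*v) (jacobian ?k (at (h z))) \<circ> (*v) (jacobian h (at z)) = id"
    using has_derivative_id has_derivative_unique by blast
  then show ?thesis
    by (metis comp_apply id_apply)
qed

lemma conjugate_solution_push:
  assumes h: "diffeomorphism S T h"
    and conj: "\<And>z. z \<in> S \<Longrightarrow> jacobian h (at z) *v G z = F (h z)"
    and z: "solution G S J z"
  shows "solution F T J (h \<circ> z)"
proof (rule solution_compose[OF z, where h' = "\<lambda>z. (*v) (jacobian h (at z))"])
  fix z assume "z \<in> S"
  then show "(h has_derivative (*v) (jacobian h (at z))) (at z)"
    using h by (intro C1_on_has_derivative) (auto simp: diffeomorphism_def)
  show "h z \<in> T \<and> jacobian h (at z) *v G z = F (h z)"
    using h conj[OF \<open>z \<in> S\<close>] \<open>z \<in> S\<close> by (auto simp: diffeomorphism_def bij_betw_def)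
qed

text \<open>The conjugacy is assumed for \<open>h\<close> only; multiplying it by the Jacobian of
  the inverse map turns it into the relation needed for the way back.\<close>

lemma conjugate_solution_pull:
  assumes h: "diffeomorphism S T h"
    and conj: "\<And>z. z \<in> S \<Longrightarrow> jacobian h (at z) *v G z = F (h z)"
    and x: "solution F T J x"
  shows "solution G S J (the_inv_into S h \<circ> x)"
proof (rule solution_compose[OF x, where h' = "\<lambda>x. (*v) (jacobian (the_inv_into S h) (at x))"])
  fix x assume "x \<in> T"
  then show "(the_inv_into S h has_derivative (*v) (jacobian (the_inv_into S h) (at x))) (at x)"
    using h by (intro C1_on_has_derivative) (auto simp: diffeomorphism_def)
  from \<open>x \<in> T\<close> obtain z where z: "z \<in> S" "x = h z" "inj_on h S"
    using h by (auto simp: diffeomorphism_def bij_betw_def)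
  then show "the_inv_into S h x \<in> S \<and>
      jacobian (the_inv_into S h) (at x) *v F x = G (the_inv_into S h x)"
    using jacobian_the_inv_into[OF h z(1), of "G z"] conj by (simp add: the_inv_into_f_f)
qed

text \<open>A solution is pulled back, continued inside \<open>E\<close>, and pushed forward again.
  The last step is legitimate because \<open>E \<subseteq> S\<close> keeps the continuation in the
  domain of \<open>h\<close>.\<close>

lemma conjugate_positively_invariant:
  assumes h: "diffeomorphism S T h"
    and conj: "\<And>z. z \<in> S \<Longrightarrow> jacobian h (at z) *v G z = F (h z)"
    and inv: "positively_invariant G UNIV E" and "E \<subseteq> S"
  shows "positively_invariant F T (h ` E)"
  unfolding positively_invariant_def
proof (intro conjI allI impI)
  have bij: "inj_on h S" "h ` S = T"
    using h by (auto simp: diffeomorphism_def bij_betw_def)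
  then show "h ` E \<subseteq> T"
    using \<open>E \<subseteq> S\<close> by blast
  fix J x assume x: "solution F T J x \<and> x 0 \<in> h ` E"
  let ?z = "the_inv_into S h \<circ> x"
  have z: "solution G UNIV J ?z"
    using conjugate_solution_pull[OF h conj] x solution_subset by blast
  moreover have z0: "?z 0 \<in> E"
    using x \<open>E \<subseteq> S\<close> by (auto simp: the_inv_into_f_f[OF bij(1)] subset_iff)
  ultimately obtain y where y: "solution G UNIV {0..} y" "\<forall>t\<in>J. y t = ?z t" "\<forall>t>0. y t \<in> E"
    using inv unfolding positively_invariant_def by blast
  \<comment> \<open>\<open>positively_invariant\<close> speaks of positive times only; at time 0
    membership comes from agreement with \<open>?z\<close>, as 0 lies in \<open>J\<close>.\<close>
  have "y t \<in> E" if "t \<ge> 0" for t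
    using y z0 z that by (cases "t = 0") (auto simp: solution_def)
  with y(1) \<open>E \<subseteq> S\<close> have "solution G S {0..} y"
    by (auto simp: solution_def)
  then have "solution F T {0..} (h \<circ> y)"
    using conjugate_solution_push[OF h conj] by blast
  moreover have "(h \<circ> y) t = x t" if "t \<in> J" for t
    using that x y(2) bij by (simp add: solution_def f_the_inv_into_f)
  moreover have "(h \<circ> y) t \<in> h ` E" if "t > 0" for t
    using that y(3) by simp
  ultimately show "\<exists>y. solution F T {0..} y \<and> (\<forall>t\<in>J. y t = x t) \<and> (\<forall>t>0. y t \<in> h ` E)"
    by blast
qed

section \<open>The input constraint\<close>

lemma relu_network_continuous:
  "continuous_on S (\<lambda>(z, v). relu_network W1 b1 W2 b2 z v)"
proof -
  have stack: "continuous_on S (\<lambda>p. stack (fst p) (snd p))"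
    unfolding stack_def
  proof (intro continuous_on_vec_lambda)
    fix i show "continuous_on S (\<lambda>p. case i of Inl j \<Rightarrow> fst p $ j | Inr _ \<Rightarrow> snd p)"
      by (cases i) (auto intro!: continuous_intros)
  qed
  show ?thesis
    unfolding relu_network_def relu_def case_prod_unfold
    by (intro continuous_intros stack continuous_on_compose2[OF
          matrix_vector_mult_linear_continuous_on[of UNIV]]) auto
qed

text \<open>The margin \<open>err\<close> in the inner set absorbs the approximation error, by the
  triangle inequality. A real supremum dominates the values only if they are bounded above;
  compactness of \<open>Zw\<close> and continuity of both maps provide this.\<close>

lemma inner_constraint_set_bound:
  assumes "compact Zw" "continuous_on Zw (\<lambda>(z, v). \<phi> z v)" "continuous_on Zw (\<lambda>(z, v). \<psi> z v)"
    and err: "(SUP (z, v)\<in>Zw. \<bar>\<phi> z v - \<psi> z v\<bar>) \<le> err"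
    and zv: "(z, v) \<in> inner_constraint_set Zw \<psi> ubar err"
  shows "\<bar>\<phi> z v\<bar> \<le> ubar"
proof -
  have "continuous_on Zw (\<lambda>(z, v). \<bar>\<phi> z v - \<psi> z v\<bar>)"
    using assms(2,3) by (auto simp: case_prod_unfold intro!: continuous_intros)
  then have "bdd_above ((\<lambda>(z, v). \<bar>\<phi> z v - \<psi> z v\<bar>) ` Zw)"
    using \<open>compact Zw\<close> by (intro bounded_imp_bdd_above compact_imp_bounded compact_continuous_image)
  then have "\<bar>\<phi> z v - \<psi> z v\<bar> \<le> err"
    using cSUP_upper[of "(z, v)" Zw "\<lambda>(z, v). \<bar>\<phi> z v - \<psi> z v\<bar>"] err zv
    by (simp add: inner_constraint_set_def)
  moreover have "\<bar>\<psi> z v\<bar> \<le> ubar - err"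
    using zv by (simp add: inner_constraint_set_def)
  ultimately show ?thesis by linarith
qed

section \<open>Both claims for the flat system\<close>

theorem proposition2:
  fixes f g :: "('n::{finite,linorder}) rvec \<Rightarrow> 'n rvec"
    and Dz Dx :: "'n rvec set"
    and \<phi>x :: "'n rvec \<Rightarrow> 'n rvec"
    and \<phi>u :: "'n rvec \<Rightarrow> real \<Rightarrow> real"
    and W1 :: "((real, 'n + 1) vec, 'h::finite) vec" and b1 :: "real^'h"
    and W2 :: "real^'h^1" and b2 :: "real^1"
    and Zw :: "('n rvec \<times> real) set"
    and K :: "'n rvec^1" and P :: "('n rvec, 'n) vec"
    and ubar err \<kappa> \<epsilon> :: real
  assumes "ubar > 0"
    and "linearizing_maps f g Dz Dx \<phi>x \<phi>u"
    and "compact Zw" and "Zw \<subseteq> Dz \<times> UNIV"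
    and "(SUP (z, v)\<in>Zw. \<bar>\<phi>u z v - relu_network W1 b1 W2 b2 z v\<bar>) \<le> err"
    and "pos_def_matrix P"
    and "\<kappa> > 0"
    and "\<And>z. gradient (quad P) z \<bullet> ((chain_A + chain_B ** K) *v z) \<le> - \<kappa> * quad P z"
    and "\<epsilon> > 0"
    and "ellipsoid P \<epsilon> \<subseteq>
           {z. (z, linear_feedback K z)
                 \<in> inner_constraint_set Zw (relu_network W1 b1 W2 b2) ubar err}"
  shows
   "(positively_invariant (closed_loop linear_dynamics (linear_feedback K)) UNIV
       (ellipsoid P \<epsilon>) \<and>
     (\<forall>z\<in>ellipsoid P \<epsilon>. \<bar>\<phi>u z (linear_feedback K z)\<bar> \<le> ubar))
    \<and>
    (let V\<^sub>x = lyapunov_x Dz \<phi>x P;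
         X\<^sub>K = {x \<in> Dx. V\<^sub>x x \<le> \<epsilon>};
         \<mu>\<^sub>K = feedback_x Dz \<phi>x \<phi>u K;
         F = closed_loop (affine_dynamics f g) \<mu>\<^sub>K
     in positively_invariant F Dx X\<^sub>K \<and>
        (\<forall>x\<in>X\<^sub>K. \<bar>\<mu>\<^sub>K x\<bar> \<le> ubar) \<and>
        control_lyapunov_function F Dx X\<^sub>K V\<^sub>x)"
proof -
  let ?M = "chain_A + chain_B ** K" and ?h = "the_inv_into Dz \<phi>x"
  let ?\<mu> = "feedback_x Dz \<phi>x \<phi>u K"
  let ?F = "closed_loop (affine_dynamics f g) ?\<mu>"
  let ?V = "lyapunov_x Dz \<phi>x P"
  note P = assms(6) and \<kappa> = assms(7) and decay = assms(8) and sub = assms(10)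
  have P_sym: "transpose P = P"
    using P by (simp add: pos_def_matrix_def)
  have diffeo: "diffeomorphism Dz Dx \<phi>x"
    and bij: "inj_on \<phi>x Dz" "\<phi>x ` Dz = Dx" and zero: "0 \<in> Dz" "\<phi>x 0 = 0"
    and \<phi>u_cont: "continuous_on (Dz \<times> UNIV) (\<lambda>(z, v). \<phi>u z v)"
    and lin: "\<And>z v. z \<in> Dz \<Longrightarrow>
      jacobian \<phi>x (at z) *v linear_dynamics z v = affine_dynamics f g (\<phi>x z) (\<phi>u z v)"
    using assms(2) by (auto simp: linearizing_maps_def diffeomorphism_def bij_betw_def)
  \<comment> \<open>The pairs \<open>(z, K z)\<close> lie in \<open>Zw\<close>, hence over
    \<open>Dz\<close>; this makes the ellipsoid transportable by \<open>\<phi>x\<close>.\<close>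
  have E_Dz: "ellipsoid P \<epsilon> \<subseteq> Dz"
    using sub assms(4) by (auto simp: inner_constraint_set_def)
  have h: "?h (\<phi>x z) = z" if "z \<in> Dz" for z
    using that by (simp add: the_inv_into_f_f[OF bij(1)])
  \<comment> \<open>The linearization identity at the input \<open>v = K z\<close>: in the original
    coordinates this input is exactly \<open>feedback_x\<close>.\<close>
  have conj: "jacobian \<phi>x (at z) *v (?M *v z) = ?F (\<phi>x z)" if "z \<in> Dz" for z
    using lin[OF that, of "linear_feedback K z"]
    by (simp add: closed_loop_linear[THEN fun_cong, symmetric])
      (simp add: closed_loop_def feedback_x_def h[OF that])
  have inv: "positively_invariant ((*v) ?M) UNIV (ellipsoid P \<epsilon>)"
    by (rule ellipsoid_positively_invariant[OF P \<kappa> decay])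
  \<comment> \<open>On \<open>Dz\<close>, composing \<open>?V\<close> with \<open>\<phi>x\<close>
    gives back \<open>quad P\<close>, so the sublevel sets correspond.\<close>
  have X: "{x \<in> Dx. ?V x \<le> \<epsilon>} = \<phi>x ` ellipsoid P \<epsilon>"
    using E_Dz bij(2) h by (auto simp: lyapunov_x_def ellipsoid_def image_iff)
  have bound: "\<bar>\<phi>u z (linear_feedback K z)\<bar> \<le> ubar" if "z \<in> ellipsoid P \<epsilon>" for z
    using inner_constraint_set_bound[OF assms(3) continuous_on_subset[OF \<phi>u_cont assms(4)]
        relu_network_continuous assms(5)] sub that by blast
  have V_pos: "?V x > 0" if "x \<in> Dx" "x \<noteq> 0" for x
  proof -
    obtain z where z: "z \<in> Dz" "x = \<phi>x z"
      using \<open>x \<in> Dx\<close> bij(2) by blast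
    then have "z \<noteq> 0"
      using \<open>x \<noteq> 0\<close> zero(2) by blast
    then show ?thesis
      using P z h by (simp add: lyapunov_x_def pos_def_matrix_def)
  qed
  have "control_lyapunov_function ?F Dx {x \<in> Dx. ?V x \<le> \<epsilon>} ?V"
    unfolding control_lyapunov_function_def
  proof (intro conjI ballI allI impI)
    show "?V 0 = 0"
      using h[OF zero(1)] zero(2) by (simp add: lyapunov_x_def quad_def)
  next
    fix x assume "x \<in> Dx" "x \<noteq> 0"
    then show "?V x > 0" by (rule V_pos)
  next
    fix J x s t
    assume "solution ?F Dx J x \<and> x 0 \<in> {x \<in> Dx. ?V x \<le> \<epsilon>}"
    then have x: "solution ?F Dx J x" by blast
    assume st: "s \<in> J" "t \<in> J" "s < t"
    let ?z = "?h \<circ> x"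
    have z: "solution ((*v) ?M) Dz J ?z"
      by (rule conjugate_solution_pull[OF diffeo conj x])
    \<comment> \<open>\<open>?V\<close> along \<open>x\<close> is \<open>quad P\<close> along the
      pulled-back solution \<open>?z\<close>. Strict decrease then follows since the exponential
      factor is below 1 and \<open>?V (x s)\<close> is positive away from the equilibrium.\<close>
    have decr: "?V (x t) \<le> exp (- \<kappa> * (t - s)) * ?V (x s)"
      using quad_decay[OF P_sym decay solution_subset[OF z subset_UNIV] st(1,2)] st(3)
      by (simp add: lyapunov_x_def)
    have lt: "exp (- \<kappa> * (t - s)) < 1"
      using st(3) \<kappa> by simp
    have pos: "?V (x s) \<ge> 0"
      using pos_def_nonneg[OF P] by (simp add: lyapunov_x_def)
    from decr lt pos show "?V (x t) \<le> ?V (x s)"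
      by (meson less_imp_le mult_left_le_one_le exp_ge_zero order_trans)
    assume "x s \<noteq> 0"
    moreover have "x s \<in> Dx"
      using x st(1) by (simp add: solution_def)
    ultimately have "?V (x s) > 0"
      by (intro V_pos)
    from mult_strict_right_mono[OF lt this] decr show "?V (x t) < ?V (x s)"
      by linarith
  qed
  moreover have "positively_invariant ?F Dx {x \<in> Dx. ?V x \<le> \<epsilon>}"
    unfolding X by (rule conjugate_positively_invariant[OF diffeo conj inv E_Dz])
  moreover have "\<bar>?\<mu> x\<bar> \<le> ubar" if "x \<in> {x \<in> Dx. ?V x \<le> \<epsilon>}" for x
    using that bound E_Dz h unfolding X by (auto simp: feedback_x_def subset_iff)
  ultimately show ?thesis
    using inv bound by (simp add: closed_loop_linear)
qed

end
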